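(* Let $X$ be a non-negative random variable with absolutely continuous distribution function $F$ and finite mean. Then $$2\,\mathcal{CRJ}(X)-2\,\mathcal{CJ}(X)=GMD,$$ where $\mathcal{CRJ}(X)$ is the cumulative residual extropy, $\mathcal{CJ}(X)$ the cumulative extropy, and $GMD$ the Gini mean difference of $X$.
   Context: $\bar F(x)=1-F(x)=P(X>x)$. The definitions are $$\mathcal{CRJ}(X)=-\frac12\int_0^\infty\bar F^2(x)\,dx,\qquad \mathcal{CJ}(X)=-\frac12\int_0^\infty\big(1-F^2(x)\big)\,dx,$$ and $GMD=E|X_1-X_2|$ with $X_1,X_2$ independent with distribution function $F$. *)

theory Defs
  imports "HOL-Probability.Probability"
begin

(* Absolute continuity of a function of a real variable. The library constant
   absolutely_continuous relates two measures. A finite family of intervals is given as the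
   set of its endpoint pairs; no interval is counted twice or lost, as all are nondegenerate. *)
definition absolutely_continuous_fun_on :: "real set \<Rightarrow> (real \<Rightarrow> real) \<Rightarrow> bool" where
  "absolutely_continuous_fun_on S f \<longleftrightarrow>
     (\<forall>\<epsilon>>0. \<exists>\<delta>>0. \<forall>D. finite D \<longrightarrow>
        (\<forall>(a, b)\<in>D. a < b \<and> {a..b} \<subseteq> S) \<longrightarrow>
        disjoint_family_on (\<lambda>(a, b). {a<..<b}) D \<longrightarrow>
        (\<Sum>(a, b)\<in>D. b - a) < \<delta> \<longrightarrow>
        (\<Sum>(a, b)\<in>D. \<bar>f b - f a\<bar>) < \<epsilon>)"

definition distribution_function :: "'a measure \<Rightarrow> ('a \<Rightarrow> real) \<Rightarrow> real \<Rightarrow> real" where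
  "distribution_function M X = cdf (distr M borel X)"

definition survival_function :: "'a measure \<Rightarrow> ('a \<Rightarrow> real) \<Rightarrow> real \<Rightarrow> real" where
  "survival_function M X x = 1 - distribution_function M X x"

definition cumulative_residual_extropy :: "'a measure \<Rightarrow> ('a \<Rightarrow> real) \<Rightarrow> real" where
  "cumulative_residual_extropy M X =
     - (1 / 2) * (LINT x:{0..}|lborel. (survival_function M X x)\<^sup>2)"

definition cumulative_extropy :: "'a measure \<Rightarrow> ('a \<Rightarrow> real) \<Rightarrow> real" where
  "cumulative_extropy M X =
     - (1 / 2) * (LINT x:{0..}|lborel. 1 - (distribution_function M X x)\<^sup>2)"

end

theory Submission
  imports Defs
begin

text \<open>Since \<^term>\<open>\<bar>a - b\<bar>\<close> is the measure of the levels that separate \<^term>\<open>a\<close> from \<^term>\<open>b\<close>,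
  Tonelli's theorem turns the Gini mean difference into the integral over \<^term>\<open>x\<close> of the probability
  that \<^term>\<open>x\<close> separates the two copies, which is \<open>2 F (1 - F)\<close> by independence. On the other side
  \<open>(1 - F\<^sup>2) - (1 - F)\<^sup>2 = 2 F (1 - F)\<close>, and the finite mean makes both terms integrable.\<close>

text \<open>\<open>ennreal\<close> sends negative numbers to 0, so the integrand is the length of
  \<open>{g \<omega>..<h \<omega>}\<close> even where this interval is empty. Swapping the two
  integrals leaves, for each level, the measure of the points whose interval contains it.\<close>

lemma (in sigma_finite_measure) nn_integral_diff_eq_nn_integral_levels:
  fixes g h :: "'a \<Rightarrow> real"
  assumes [measurable]: "g \<in> borel_measurable M" "h \<in> borel_measurable M"
  shows "(\<integral>\<^sup>+ \<omega>. ennreal (h \<omega> - g \<omega>) \<partial>M)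
    = (\<integral>\<^sup>+ x. emeasure M {\<omega> \<in> space M. g \<omega> \<le> x \<and> x < h \<omega>} \<partial>lborel)"
proof -
  interpret pair_sigma_finite M lborel ..
  \<comment> \<open>A conditional on two inequalities displays the joint measurability in
    \<open>\<omega>\<close> and \<open>x\<close> that Tonelli's theorem requires.\<close>
  let ?i = "\<lambda>\<omega> x. if g \<omega> \<le> x \<and> x < h \<omega> then 1 else 0 :: ennreal"
  have "(\<integral>\<^sup>+ x. ?i \<omega> x \<partial>lborel) = ennreal (h \<omega> - g \<omega>)" for \<omega>
  proof -
    have "(\<integral>\<^sup>+ x. ?i \<omega> x \<partial>lborel) = (\<integral>\<^sup>+ x. indicator {g \<omega>..<h \<omega>} x \<partial>lborel)"
      by (intro nn_integral_cong) (auto simp: indicator_def)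
    also have "\<dots> = ennreal (h \<omega> - g \<omega>)"
      by (cases "g \<omega> \<le> h \<omega>") (auto simp: ennreal_neg)
    finally show ?thesis .
  qed
  then have "(\<integral>\<^sup>+ \<omega>. ennreal (h \<omega> - g \<omega>) \<partial>M) = (\<integral>\<^sup>+ \<omega>. (\<integral>\<^sup>+ x. ?i \<omega> x \<partial>lborel) \<partial>M)"
    by simp
  also have "\<dots> = (\<integral>\<^sup>+ x. (\<integral>\<^sup>+ \<omega>. ?i \<omega> x \<partial>M) \<partial>lborel)"
    by (rule Fubini'[symmetric]) measurable
  also have "\<dots> = (\<integral>\<^sup>+ x. emeasure M {\<omega> \<in> space M. g \<omega> \<le> x \<and> x < h \<omega>} \<partial>lborel)"
  proof (rule nn_integral_cong)
    fix x :: real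
    have "(\<integral>\<^sup>+ \<omega>. ?i \<omega> x \<partial>M)
      = (\<integral>\<^sup>+ \<omega>. indicator {\<omega> \<in> space M. g \<omega> \<le> x \<and> x < h \<omega>} \<omega> \<partial>M)"
      by (intro nn_integral_cong) (auto simp: indicator_def)
    also have "\<dots> = emeasure M {\<omega> \<in> space M. g \<omega> \<le> x \<and> x < h \<omega>}"
      by (intro nn_integral_indicator) measurable
    finally show "(\<integral>\<^sup>+ \<omega>. ?i \<omega> x \<partial>M) = emeasure M {\<omega> \<in> space M. g \<omega> \<le> x \<and> x < h \<omega>}" .
  qed
  finally show ?thesis .
qed

context prob_space
begin

lemma distribution_function_eq_prob:
  assumes [measurable]: "X \<in> borel_measurable M"
  shows "distribution_function M X x = prob {\<omega> \<in> space M. X \<omega> \<le> x}"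
proof -
  have "X -` {..x} \<inter> space M = {\<omega> \<in> space M. X \<omega> \<le> x}"
    by auto
  then show ?thesis
    by (simp add: distribution_function_def cdf_def measure_distr)
qed

lemma survival_function_eq_prob:
  assumes [measurable]: "X \<in> borel_measurable M"
  shows "survival_function M X x = prob {\<omega> \<in> space M. x < X \<omega>}"
  using prob_neg[of "\<lambda>\<omega>. X \<omega> \<le> x"]
  by (simp add: survival_function_def distribution_function_eq_prob[OF assms] not_le)

lemma distribution_function_measurable:
  assumes "X \<in> borel_measurable M"
  shows "distribution_function M X \<in> borel_measurable borel"
proof -
  interpret D: real_distribution "distr M borel X"
    using assms by simp
  show ?thesis
    unfolding distribution_function_def
    by (intro borel_measurable_mono) (auto simp: mono_def D.cdf_nondecreasing)
qed

lemma survival_function_measurable: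
  assumes "X \<in> borel_measurable M"
  shows "survival_function M X \<in> borel_measurable borel"
  using distribution_function_measurable[OF assms]
  by (subst survival_function_def[abs_def]) measurable

text \<open>The tail integral over the half-line is the integral of the positive part of
  \<open>X\<close>, which is finite because \<open>X\<close> is integrable.\<close>

lemma set_integrable_survival_function:
  assumes [measurable]: "X \<in> borel_measurable M" and int: "integrable M X"
  shows "set_integrable lborel {0..} (survival_function M X)"
  unfolding set_integrable_def
proof (rule integrableI_nonneg)
  note [measurable] = survival_function_measurable[OF assms(1)]
  show "(\<lambda>x. indicator {0..} x *\<^sub>R survival_function M X x) \<in> borel_measurable lborel"
    by measurable
  show "AE x in lborel. 0 \<le> indicator {0..} x *\<^sub>R survival_function M X x"
    by (simp add: survival_function_eq_prob)
  \<comment> \<open>The indicator moves into the event as the condition \<open>0 \<le> x\<close>,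
    which gives the level formula with lower function 0.\<close>
  have "(\<integral>\<^sup>+ x. ennreal (indicator {0..} x *\<^sub>R survival_function M X x) \<partial>lborel)
    = (\<integral>\<^sup>+ x. emeasure M {\<omega> \<in> space M. 0 \<le> x \<and> x < X \<omega>} \<partial>lborel)"
    by (intro nn_integral_cong)
      (auto simp: indicator_def survival_function_eq_prob emeasure_eq_measure)
  also have "\<dots> = (\<integral>\<^sup>+ \<omega>. ennreal (X \<omega>) \<partial>M)"
    using nn_integral_diff_eq_nn_integral_levels[of "\<lambda>_. 0" X] by simp
  also have "\<dots> < \<infinity>"
    using int by (simp add: real_integrable_def top.not_eq_extremum)
  finally show "(\<integral>\<^sup>+ x. ennreal (indicator {0..} x *\<^sub>R survival_function M X x) \<partial>lborel) < \<infinity>" .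
qed

lemma indep_set_commute:
  assumes "indep_set A B"
  shows "indep_set B A"
  unfolding indep_sets2_eq
proof (intro conjI ballI)
  fix b a
  assume "b \<in> B" "a \<in> A"
  then have "prob (a \<inter> b) = prob a * prob b"
    using assms by (simp add: indep_sets2_eq)
  then show "prob (b \<inter> a) = prob b * prob a"
    by (simp add: Int_commute mult.commute)
qed (use assms in \<open>simp_all add: indep_sets2_eq\<close>)

lemma indep_var_commute:
  assumes "indep_var S Y T Z"
  shows "indep_var T Z S Y"
  using assms by (auto simp only: indep_var_eq intro: indep_set_commute)

text \<open>The event is the preimage of the rectangle \<open>{..x} \<times> {x<..}\<close> under
  the pair, so independence factors its probability.\<close>

lemma indep_var_emeasure_level_between:
  assumes ind: "indep_var borel Y borel Z"
  shows "emeasure M {\<omega> \<in> space M. Y \<omega> \<le> x \<and> x < Z \<omega>}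
    = ennreal (distribution_function M Y x * survival_function M Z x)"
proof -
  have [measurable]: "Y \<in> borel_measurable M" "Z \<in> borel_measurable M"
    using indep_var_rv1[OF ind] indep_var_rv2[OF ind] by auto
  have "prob ((\<lambda>\<omega>. (Y \<omega>, Z \<omega>)) -` ({..x} \<times> {x<..}) \<inter> space M)
    = prob (Y -` {..x} \<inter> space M) * prob (Z -` {x<..} \<inter> space M)"
    using indep_varD[OF ind, of "{..x}" "{x<..}"] by simp
  moreover have "(\<lambda>\<omega>. (Y \<omega>, Z \<omega>)) -` ({..x} \<times> {x<..}) \<inter> space M
      = {\<omega> \<in> space M. Y \<omega> \<le> x \<and> x < Z \<omega>}"
    "Y -` {..x} \<inter> space M = {\<omega> \<in> space M. Y \<omega> \<le> x}"
    "Z -` {x<..} \<inter> space M = {\<omega> \<in> space M. x < Z \<omega>}"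
    by auto
  ultimately show ?thesis
    by (simp add: emeasure_eq_measure distribution_function_eq_prob survival_function_eq_prob)
qed

lemma expectation_abs_diff_indep_var:
  assumes ind: "indep_var borel Y borel Z"
  shows "expectation (\<lambda>\<omega>. \<bar>Y \<omega> - Z \<omega>\<bar>)
    = (LINT x|lborel. distribution_function M Y x * survival_function M Z x
                    + distribution_function M Z x * survival_function M Y x)"
proof -
  have [measurable]: "Y \<in> borel_measurable M" "Z \<in> borel_measurable M"
    using indep_var_rv1[OF ind] indep_var_rv2[OF ind] by auto
  have [measurable]: "distribution_function M Y \<in> borel_measurable borel"
      "distribution_function M Z \<in> borel_measurable borel"
      "survival_function M Y \<in> borel_measurable borel"
      "survival_function M Z \<in> borel_measurable borel"
    by (simp_all add: distribution_function_measurable survival_function_measurable)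
  have nonneg: "0 \<le> distribution_function M Y x" "0 \<le> distribution_function M Z x"
      "0 \<le> survival_function M Y x" "0 \<le> survival_function M Z x" for x
    by (simp_all add: distribution_function_eq_prob survival_function_eq_prob)
  have ind': "indep_var borel Z borel Y"
    using ind by (rule indep_var_commute)
  \<comment> \<open>At most one of the two differences is positive, and \<open>ennreal\<close> sends
    the other to 0. Each summand then falls under the level formula, the second one with the roles
    of \<open>Y\<close> and \<open>Z\<close> exchanged.\<close>
  have "ennreal \<bar>Y \<omega> - Z \<omega>\<bar> = ennreal (Z \<omega> - Y \<omega>) + ennreal (Y \<omega> - Z \<omega>)" for \<omega>
    by (cases "Y \<omega> \<le> Z \<omega>") (auto simp: ennreal_neg)
  then have "(\<integral>\<^sup>+ \<omega>. ennreal \<bar>Y \<omega> - Z \<omega>\<bar> \<partial>M)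
      = (\<integral>\<^sup>+ \<omega>. ennreal (Z \<omega> - Y \<omega>) \<partial>M) + (\<integral>\<^sup>+ \<omega>. ennreal (Y \<omega> - Z \<omega>) \<partial>M)"
    by (simp add: nn_integral_add)
  also have "\<dots> = (\<integral>\<^sup>+ x. ennreal (distribution_function M Y x * survival_function M Z x) \<partial>lborel)
      + (\<integral>\<^sup>+ x. ennreal (distribution_function M Z x * survival_function M Y x) \<partial>lborel)"
    by (simp add: nn_integral_diff_eq_nn_integral_levels indep_var_emeasure_level_between ind ind')
  also have "\<dots> = (\<integral>\<^sup>+ x. ennreal (distribution_function M Y x * survival_function M Z x
                    + distribution_function M Z x * survival_function M Y x) \<partial>lborel)"
    by (simp add: nn_integral_add nonneg)
  finally have "(\<integral>\<^sup>+ \<omega>. ennreal \<bar>Y \<omega> - Z \<omega>\<bar> \<partial>M) = \<dots>" .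
  \<comment> \<open>Both integrands are nonnegative, so each Bochner integral is
    \<open>enn2real\<close> of the same extended value. If that value is infinite, both sides take
    the default value 0.\<close>
  then show ?thesis
    by (simp add: integral_eq_nn_integral nonneg)
qed

end

theorem mainTheorem6:
  fixes M :: "'a measure" and X :: "'a \<Rightarrow> real"
    and N :: "'b measure" and X1 X2 :: "'b \<Rightarrow> real"
  assumes "prob_space M"
    and "X \<in> borel_measurable M"
    and "AE \<omega> in M. 0 \<le> X \<omega>"
    and "absolutely_continuous_fun_on UNIV (distribution_function M X)"
    and "integrable M X"
    and "prob_space N"
    and "prob_space.indep_var N borel X1 borel X2"
    and "distribution_function N X1 = distribution_function M X"
    and "distribution_function N X2 = distribution_function M X"
  shows "2 * cumulative_residual_extropy M X - 2 * cumulative_extropy M X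
       = prob_space.expectation N (\<lambda>\<omega>. \<bar>X1 \<omega> - X2 \<omega>\<bar>)"
proof -
  interpret M: prob_space M by fact
  interpret N: prob_space N by fact
  let ?F = "distribution_function M X" and ?S = "survival_function M X"
  note [measurable] = assms(2) M.distribution_function_measurable[OF assms(2)]
    M.survival_function_measurable[OF assms(2)]
  have S: "?S x = 1 - ?F x" for x
    by (simp add: survival_function_def)
  have F: "0 \<le> ?F x" "?F x \<le> 1" for x
    by (simp_all add: M.distribution_function_eq_prob)
  \<comment> \<open>This is where nonnegativity of \<open>X\<close> enters: it later allows
    integrals over the half-line to be replaced by integrals over the whole line.\<close>
  have F_neg: "?F x = 0" if "x < 0" for x
  proof -
    have "AE \<omega> in M. \<not> X \<omega> \<le> x"
      using assms(3) that by (auto elim!: eventually_mono)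
    then show ?thesis
      by (simp add: M.distribution_function_eq_prob M.prob_eq_0)
  qed
  have S_int: "set_integrable lborel {0..} ?S"
    using assms by (intro M.set_integrable_survival_function)
  \<comment> \<open>Since \<open>?S x\<close> lies between 0 and 1, its square is dominated by
    \<open>?S x\<close> itself.\<close>
  have int1: "set_integrable lborel {0..} (\<lambda>x. (?S x)\<^sup>2)"
    using S_int unfolding set_integrable_def
    by (rule Bochner_Integration.integrable_bound)
      (auto simp: indicator_def S power2_eq_square F intro!: mult_left_le)
  \<comment> \<open>The dominating function comes from the factorization
    \<open>1 - F^2 = (1 + F) * S\<close>, whose first factor is at most 2.\<close>
  have "set_integrable lborel {0..} (\<lambda>x. 2 * ?S x)"
    using S_int by simp
  then have int2: "set_integrable lborel {0..} (\<lambda>x. 1 - (?F x)\<^sup>2)"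
    unfolding set_integrable_def
  proof (rule Bochner_Integration.integrable_bound)
    have "\<bar>1 - (?F x)\<^sup>2\<bar> \<le> 2 * \<bar>?S x\<bar>" for x
    proof -
      have "1 - (?F x)\<^sup>2 = (1 + ?F x) * ?S x"
        by (simp add: S power2_eq_square algebra_simps)
      also have "\<bar>\<dots>\<bar> \<le> 2 * \<bar>?S x\<bar>"
        using F[of x] by (subst abs_mult, intro mult_right_mono) auto
      finally show ?thesis .
    qed
    then show "AE x in lborel. norm (indicator {0..} x *\<^sub>R (1 - (?F x)\<^sup>2))
        \<le> norm (indicator {0..} x *\<^sub>R (2 * ?S x))"
      by (auto simp: indicator_def abs_mult)
  qed measurable
  have "2 * cumulative_residual_extropy M X - 2 * cumulative_extropy M X
      = (LINT x:{0..}|lborel. 1 - (?F x)\<^sup>2) - (LINT x:{0..}|lborel. (?S x)\<^sup>2)"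
    by (simp add: cumulative_residual_extropy_def cumulative_extropy_def)
  \<comment> \<open>Merging the two integrals is legitimate because each integrand is integrable on
    its own.\<close>
  also have "\<dots> = (LINT x:{0..}|lborel. 1 - (?F x)\<^sup>2 - (?S x)\<^sup>2)"
    using int1 int2 by simp
  \<comment> \<open>On the half-line this is the identity
    \<open>(1 - F^2) - (1 - F)^2 = 2 * F * (1 - F)\<close>; on the negative axis both integrands
    vanish because \<open>?F x = 0\<close> there. The factor 2 is left as a sum of two equal
    products, the form that the formula for \<open>X1\<close> and \<open>X2\<close> takes when their
    distribution functions coincide.\<close>
  also have "\<dots> = (LINT x|lborel. ?F x * ?S x + ?F x * ?S x)"
    unfolding set_lebesgue_integral_def
    by (intro Bochner_Integration.integral_cong)
      (auto simp: indicator_def F_neg S power2_eq_square algebra_simps)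
  also have "\<dots> = N.expectation (\<lambda>\<omega>. \<bar>X1 \<omega> - X2 \<omega>\<bar>)"
    using N.expectation_abs_diff_indep_var[OF assms(7)]
    by (simp add: survival_function_def assms(8,9))
  finally show ?thesis .
qed

end
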